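(* Let $A$ be a finitely generated (discrete) abelian group, let $\mathbf{K}_1,\dots,\mathbf{K}_m$ be local fields, each with an action of $A$ by scalar multiplication (each element of $A$ acts on $\mathbf{K}_i$ as multiplication by an element of $\mathbf{K}_i^*$), and let $G=\big(\bigoplus_{i=1}^m\mathbf{K}_i\big)\rtimes A$ be the corresponding semidirect product. Assume that for every $i$ there exists an element of $A$ acting on $\mathbf{K}_i$ by contractions, i.e. by multiplication by an element of norm $<1$. Fix a multiplicative norm on each $\mathbf{K}_i$, let $S_i$ be the closed unit ball of $\mathbf{K}_i$, let $T$ be a finite symmetric generating set of $A$, and let $S=T\cup\bigcup_{i=1}^m S_i$. Let $\mathcal{F}$ be the set of words in $S$ of the form $$\left(\prod_{i=1}^m t_iv_it_i^{-1}\right)t,$$ where $v_i\in S_i$ (a single letter) and $t_1,\dots,t_m,t$ are words in the letters of $T$. Then $\mathcal{F}$ is efficient.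
   Context: A local field is a non-discrete locally compact normed field. $|w|_S$ denotes the length of the word $w$ in the letters of $S$. A set $\mathcal{F}$ of words in $S$ is called efficient if there exists a constant $C$ such that for every word $w$ in $S$ there exists $w'\in\mathcal{F}$ representing the same element of $G$ as $w$ and satisfying $|w'|_S\le C|w|_S$.
   Formalization: In the definition of efficient, w ranges over nonempty words only: every word of F contains the m letters v_i, so for m ≥ 1 the empty word has no replacement w' in F with |w'| ≤ C|w| = 0. *)

theory Defs
  imports "HOL-Analysis.Analysis" "HOL-Algebra.Algebra"
begin

locale multiplicative_norm = field K for K (structure) +
  fixes nrm :: "'a \<Rightarrow> real"
  assumes nrm_nonneg: "x \<in> carrier K \<Longrightarrow> 0 \<le> nrm x"
    and nrm_eq_0_iff: "x \<in> carrier K \<Longrightarrow> nrm x = 0 \<longleftrightarrow> x = \<zero>"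
    and nrm_triangle: "\<lbrakk>x \<in> carrier K; y \<in> carrier K\<rbrakk> \<Longrightarrow> nrm (x \<oplus> y) \<le> nrm x + nrm y"
    and nrm_mult: "\<lbrakk>x \<in> carrier K; y \<in> carrier K\<rbrakk> \<Longrightarrow> nrm (x \<otimes> y) = nrm x * nrm y"

text \<open>The value 0 off the carrier is immaterial; it is needed because the locale
  \<^locale>\<open>Metric_space\<close> demands nonnegativity and symmetry on the whole type.\<close>

definition norm_dist :: "('a, 'b) ring_scheme \<Rightarrow> ('a \<Rightarrow> real) \<Rightarrow> 'a \<Rightarrow> 'a \<Rightarrow> real" where
  "norm_dist K nrm x y =
     (if x \<in> carrier K \<and> y \<in> carrier K then nrm (x \<ominus>\<^bsub>K\<^esub> y) else 0)"

definition norm_topology :: "('a, 'b) ring_scheme \<Rightarrow> ('a \<Rightarrow> real) \<Rightarrow> 'a topology" where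
  "norm_topology K nrm = Metric_space.mtopology (carrier K) (norm_dist K nrm)"

locale local_field = multiplicative_norm +
  assumes locally_compact: "locally_compact_space (norm_topology K nrm)"
    and non_discrete: "norm_topology K nrm \<noteq> discrete_topology (carrier K)"

definition unit_ball :: "('a, 'b) ring_scheme \<Rightarrow> ('a \<Rightarrow> real) \<Rightarrow> 'a set" where
  "unit_ball K nrm = {x \<in> carrier K. nrm x \<le> 1}"

definition acts_as_scalar :: "('k, 'r) ring_scheme \<Rightarrow> ('k \<Rightarrow> 'k) \<Rightarrow> 'k \<Rightarrow> bool" where
  "acts_as_scalar K f c \<longleftrightarrow> c \<in> Units K \<and> (\<forall>x \<in> carrier K. f x = c \<otimes>\<^bsub>K\<^esub> x)"

definition scalar_action ::
    "('a, 'b) monoid_scheme \<Rightarrow> ('k, 'r) ring_scheme \<Rightarrow> ('a \<Rightarrow> 'k \<Rightarrow> 'k) \<Rightarrow> bool" where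
  "scalar_action A K \<phi> \<longleftrightarrow>
     group_action A (carrier K) \<phi> \<and> (\<forall>a \<in> carrier A. \<exists>c. acts_as_scalar K (\<phi> a) c)"

definition semidirect_product ::
    "('n, 'b) monoid_scheme \<Rightarrow> ('a, 'c) monoid_scheme \<Rightarrow> ('a \<Rightarrow> 'n \<Rightarrow> 'n) \<Rightarrow> ('n \<times> 'a) monoid" where
  "semidirect_product N A \<phi> =
     \<lparr>carrier = carrier N \<times> carrier A,
      mult = (\<lambda>(x, a) (y, b). (x \<otimes>\<^bsub>N\<^esub> \<phi> a y, a \<otimes>\<^bsub>A\<^esub> b)),
      one = (\<one>\<^bsub>N\<^esub>, \<one>\<^bsub>A\<^esub>)\<rparr>"

lemma group_semidirect_product:
  assumes N: "group N" and act: "group_action A (carrier N) \<phi>"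
    and hom: "\<And>a. a \<in> carrier A \<Longrightarrow> \<phi> a \<in> hom N N"
  shows "group (semidirect_product N A \<phi>)"
proof -
  interpret N: group N by fact
  interpret act: group_action A "carrier N" \<phi> by fact
  interpret A: group A using act.group_hom by (simp add: group_hom_def)
  have cl: "\<phi> a x \<in> carrier N" if "a \<in> carrier A" "x \<in> carrier N" for a x
    using hom[OF that(1)] that(2) by (auto simp: hom_def)
  have comp: "\<phi> (a \<otimes>\<^bsub>A\<^esub> b) x = \<phi> a (\<phi> b x)"
    if "a \<in> carrier A" "b \<in> carrier A" "x \<in> carrier N" for a b x
    using act.composition_rule[OF that(3,1,2)] .
  have id: "\<phi> \<one>\<^bsub>A\<^esub> x = x" if "x \<in> carrier N" for x
    using act.id_eq_one that by (metis restrict_apply')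
  have mul: "\<phi> a (x \<otimes>\<^bsub>N\<^esub> y) = \<phi> a x \<otimes>\<^bsub>N\<^esub> \<phi> a y"
    if "a \<in> carrier A" "x \<in> carrier N" "y \<in> carrier N" for a x y
    using hom[OF that(1)] that(2,3) by (auto simp: hom_def)
  show ?thesis
  proof (rule groupI)
    fix g assume "g \<in> carrier (semidirect_product N A \<phi>)"
    then obtain x a where g: "g = (x, a)" "x \<in> carrier N" "a \<in> carrier A"
      by (auto simp: semidirect_product_def)
    let ?h = "(\<phi> (inv\<^bsub>A\<^esub> a) (inv\<^bsub>N\<^esub> x), inv\<^bsub>A\<^esub> a)"
    have "\<phi> (inv\<^bsub>A\<^esub> a) (inv\<^bsub>N\<^esub> x) \<otimes>\<^bsub>N\<^esub> \<phi> (inv\<^bsub>A\<^esub> a) x = \<phi> (inv\<^bsub>A\<^esub> a) \<one>\<^bsub>N\<^esub>"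
      using g by (simp flip: mul)
    also have "\<dots> = \<one>\<^bsub>N\<^esub>"
      using hom[of "inv\<^bsub>A\<^esub> a"] g hom_one[OF _ N N] by simp
    finally show "\<exists>h \<in> carrier (semidirect_product N A \<phi>).
        h \<otimes>\<^bsub>semidirect_product N A \<phi>\<^esub> g = \<one>\<^bsub>semidirect_product N A \<phi>\<^esub>"
      using g cl by (intro bexI[of _ ?h]) (auto simp: semidirect_product_def)
  qed (auto simp: semidirect_product_def cl comp id mul N.m_assoc A.m_assoc)
qed

definition word_eval :: "('g, 'b) monoid_scheme \<Rightarrow> 'g list \<Rightarrow> 'g" where
  "word_eval G w = foldr (\<lambda>g h. g \<otimes>\<^bsub>G\<^esub> h) w \<one>\<^bsub>G\<^esub>"

definition word_inv :: "('g, 'b) monoid_scheme \<Rightarrow> 'g list \<Rightarrow> 'g list" where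
  "word_inv G w = rev (map (\<lambda>g. inv\<^bsub>G\<^esub> g) w)"

text \<open>The word \<^term>\<open>w\<close> to be replaced ranges over the nonempty words: the
  empty word could only be replaced by itself, so with it no family of words of positive
  length would be efficient.\<close>

definition efficient :: "('g, 'b) monoid_scheme \<Rightarrow> 'g set \<Rightarrow> 'g list set \<Rightarrow> bool" where
  "efficient G S F \<longleftrightarrow> F \<subseteq> lists S \<and>
     (\<exists>C::real. \<forall>w \<in> lists S. w \<noteq> [] \<longrightarrow>
        (\<exists>w' \<in> F. word_eval G w' = word_eval G w \<and> real (length w') \<le> C * real (length w)))"

definition field_sum :: "nat \<Rightarrow> (nat \<Rightarrow> ('k, 'r) ring_scheme) \<Rightarrow> (nat \<Rightarrow> 'k) monoid" where
  "field_sum m K = sum_group {1..m} (\<lambda>i. add_monoid (K i))"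

definition sum_action ::
    "nat \<Rightarrow> (nat \<Rightarrow> 'a \<Rightarrow> 'k \<Rightarrow> 'k) \<Rightarrow> 'a \<Rightarrow> (nat \<Rightarrow> 'k) \<Rightarrow> (nat \<Rightarrow> 'k)" where
  "sum_action m \<phi> a x = (\<lambda>i\<in>{1..m}. \<phi> i a (x i))"

text \<open>The restriction to the carrier only serves to make the action extensional, as
  \<^locale>\<open>group_action\<close> requires.\<close>

definition field_semidirect ::
    "nat \<Rightarrow> (nat \<Rightarrow> ('k, 'r) ring_scheme) \<Rightarrow> ('a, 'b) monoid_scheme \<Rightarrow> (nat \<Rightarrow> 'a \<Rightarrow> 'k \<Rightarrow> 'k)
      \<Rightarrow> ((nat \<Rightarrow> 'k) \<times> 'a) monoid" where
  "field_semidirect m K A \<phi> =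
     semidirect_product (field_sum m K) A (\<lambda>a. \<lambda>x\<in>carrier (field_sum m K). sum_action m \<phi> a x)"

definition emb_field ::
    "nat \<Rightarrow> (nat \<Rightarrow> ('k, 'r) ring_scheme) \<Rightarrow> ('a, 'b) monoid_scheme \<Rightarrow> nat \<Rightarrow> 'k \<Rightarrow> (nat \<Rightarrow> 'k) \<times> 'a" where
  "emb_field m K A i v = ((\<lambda>j\<in>{1..m}. if j = i then v else \<zero>\<^bsub>K j\<^esub>), \<one>\<^bsub>A\<^esub>)"

definition emb_group :: "nat \<Rightarrow> (nat \<Rightarrow> ('k, 'r) ring_scheme) \<Rightarrow> 'a \<Rightarrow> (nat \<Rightarrow> 'k) \<times> 'a" where
  "emb_group m K a = (\<one>\<^bsub>field_sum m K\<^esub>, a)"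

definition gen_set ::
    "nat \<Rightarrow> (nat \<Rightarrow> ('k, 'r) ring_scheme) \<Rightarrow> (nat \<Rightarrow> 'k \<Rightarrow> real) \<Rightarrow> ('a, 'b) monoid_scheme \<Rightarrow> 'a set
      \<Rightarrow> ((nat \<Rightarrow> 'k) \<times> 'a) set" where
  "gen_set m K nrm A T =
     emb_group m K ` T \<union> (\<Union>i\<in>{1..m}. emb_field m K A i ` unit_ball (K i) (nrm i))"

definition normal_words ::
    "nat \<Rightarrow> (nat \<Rightarrow> ('k, 'r) ring_scheme) \<Rightarrow> (nat \<Rightarrow> 'k \<Rightarrow> real) \<Rightarrow> ('a, 'b) monoid_scheme
      \<Rightarrow> (nat \<Rightarrow> 'a \<Rightarrow> 'k \<Rightarrow> 'k) \<Rightarrow> 'a set \<Rightarrow> ((nat \<Rightarrow> 'k) \<times> 'a) list set" where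
  "normal_words m K nrm A \<phi> T =
     {concat (map (\<lambda>i. u i @ [emb_field m K A i (v i)] @ word_inv (field_semidirect m K A \<phi>) (u i))
                [1..<Suc m]) @ t
      | u v t. (\<forall>i \<in> {1..m}. u i \<in> lists (emb_group m K ` T) \<and> v i \<in> unit_ball (K i) (nrm i))
             \<and> t \<in> lists (emb_group m K ` T)}"

end

theory Submission
  imports Defs
begin

text \<open>The \<open>A\<close>-component of a word of length \<open>n\<close> is spelled by its letters from \<open>T\<close>.
  Its \<open>K i\<close>-component has norm at most \<open>M ^ n\<close>, where \<open>M \<ge> 2\<close> bounds the norms of the
  scalars by which \<open>T\<close> acts: a letter from \<open>T\<close> scales the component, and a letter from a unit
  ball adds at most 1 to its norm. Conversely, if \<open>a\<close> contracts \<open>K i\<close>, then some power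
  \<open>a ^ k\<close> contracts by a factor at most \<open>1 / M\<close>, so \<open>a ^ (k n)\<close> moves the component into
  the unit ball; conjugating back costs linearly many letters.\<close>

section \<open>Evaluation of words in monoids and groups\<close>

lemma word_eval_Nil [simp]: "word_eval G [] = \<one>\<^bsub>G\<^esub>"
  and word_eval_Cons [simp]: "word_eval G (g # w) = g \<otimes>\<^bsub>G\<^esub> word_eval G w"
  by (simp_all add: word_eval_def)

lemma (in monoid) word_eval_closed [simp]:
  "set w \<subseteq> carrier G \<Longrightarrow> word_eval G w \<in> carrier G"
  by (induction w) auto

lemma (in monoid) word_eval_append:
  "\<lbrakk>set v \<subseteq> carrier G; set w \<subseteq> carrier G\<rbrakk> \<Longrightarrow>
    word_eval G (v @ w) = word_eval G v \<otimes> word_eval G w"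
  by (induction v) (auto simp: m_assoc)

lemma (in monoid) word_eval_concat:
  "(\<And>w. w \<in> set ws \<Longrightarrow> set w \<subseteq> carrier G) \<Longrightarrow>
    word_eval G (concat ws) = word_eval G (map (word_eval G) ws)"
proof (induction ws)
  case (Cons w ws)
  then have "set (concat ws) \<subseteq> carrier G" by auto
  with Cons show ?case by (simp add: word_eval_append)
qed simp

lemma (in monoid) word_eval_replicate:
  assumes "x \<in> carrier G"
  shows "word_eval G (replicate n x) = x [^] n"
proof (induction n)
  case (Suc n)
  then show ?case using assms by (simp flip: nat_pow_Suc2 del: nat_pow_Suc)
qed simp

lemma (in group) word_inv_closed:
  "set w \<subseteq> carrier G \<Longrightarrow> set (word_inv G w) \<subseteq> carrier G"
  by (auto simp: word_inv_def)

lemma (in group) word_eval_word_inv: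
  "set w \<subseteq> carrier G \<Longrightarrow> word_eval G (word_inv G w) = inv (word_eval G w)"
proof (induction w)
  case Nil
  then show ?case by (simp add: word_inv_def)
next
  case (Cons g w)
  have "word_inv G (g # w) = word_inv G w @ [inv g]" by (simp add: word_inv_def)
  with Cons word_inv_closed[of w] show ?case
    by (simp add: word_eval_append inv_mult_group)
qed

text \<open>Since \<open>T\<close> is symmetric, the inverse of a generator is again a single
  letter, so every clause of \<open>generate\<close> becomes a letter or a concatenation of words
  over \<open>T\<close>.\<close>

lemma (in group) generate_word_eval:
  assumes "T \<subseteq> carrier G" and sym: "\<And>s. s \<in> T \<Longrightarrow> inv s \<in> T" and "a \<in> generate G T"
  shows "\<exists>w \<in> lists T. word_eval G w = a"
  using assms(3)
proof induction
  case one
  show ?case by (rule bexI[of _ "[]"]) auto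
next
  case (incl h)
  then show ?case using assms(1) by (intro bexI[of _ "[h]"]) auto
next
  case (inv h)
  then have "inv h \<in> T" "inv h \<in> carrier G" using sym assms(1) by auto
  then show ?case by (intro bexI[of _ "[inv h]"]) auto
next
  case (eng h1 h2)
  then obtain v w where vw: "v \<in> lists T" "word_eval G v = h1" "w \<in> lists T" "word_eval G w = h2"
    by blast
  then have "set v \<subseteq> carrier G" "set w \<subseteq> carrier G" using assms(1) by auto
  then have "word_eval G (v @ w) = h1 \<otimes> h2" using vw by (simp add: word_eval_append)
  then show ?case using vw by (intro bexI[of _ "v @ w"]) auto
qed

section \<open>Scalar actions on a single normed field\<close>

context multiplicative_norm
begin

lemma nrm_zero [simp]: "nrm \<zero> = 0"
  by (simp add: nrm_eq_0_iff)

text \<open>A scalar is determined by its effect on the unit. This gives a canonical name for the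
  scalar by which \<open>a\<close> acts, the value of \<open>\<phi> i a\<close> at the unit of
  \<open>K i\<close>, so that no scalar has to be chosen later.\<close>

lemma acts_as_scalar_imp_eq:
  "acts_as_scalar K f c \<Longrightarrow> c = f \<one>"
  by (auto simp: acts_as_scalar_def)

end

locale scalar_semidirect = comm_group A
  for A :: "('a, 'b) monoid_scheme" (structure) +
  fixes m :: nat and K :: "nat \<Rightarrow> ('k, 'r) ring_scheme"
    and nrm :: "nat \<Rightarrow> 'k \<Rightarrow> real" and \<phi> :: "nat \<Rightarrow> 'a \<Rightarrow> 'k \<Rightarrow> 'k"
  assumes multiplicative_norm: "i \<in> {1..m} \<Longrightarrow> multiplicative_norm (K i) (nrm i)"
    and scalar_action: "i \<in> {1..m} \<Longrightarrow> scalar_action A (K i) (\<phi> i)"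
begin

abbreviation "N \<equiv> field_sum m K"
abbreviation "G \<equiv> field_semidirect m K A \<phi>"
abbreviation "emb \<equiv> emb_field m K A"

lemma ring_K: "i \<in> {1..m} \<Longrightarrow> ring (K i)"
  using multiplicative_norm[of i]
  by (simp add: multiplicative_norm_def field_def domain_def cring_def)

lemma group_add_K: "i \<in> {1..m} \<Longrightarrow> group (add_monoid (K i))"
  by (rule abelian_group.a_group[OF ring.is_abelian_group[OF ring_K]])

context
  fixes i assumes i: "i \<in> {1..m}"
begin

interpretation K: multiplicative_norm "K i" "nrm i" by (rule multiplicative_norm[OF i])

interpretation act: group_action A "carrier (K i)" "\<phi> i"
  using scalar_action[OF i] by (simp add: scalar_action_def)

lemma act_eq_mult:
  assumes "a \<in> carrier A" "x \<in> carrier (K i)"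
  shows "\<phi> i a x = \<phi> i a \<one>\<^bsub>K i\<^esub> \<otimes>\<^bsub>K i\<^esub> x"
proof -
  obtain c where c: "acts_as_scalar (K i) (\<phi> i a) c"
    using scalar_action[OF i] assms by (auto simp: scalar_action_def)
  then have "\<phi> i a x = c \<otimes>\<^bsub>K i\<^esub> x" using assms by (simp add: acts_as_scalar_def)
  then show ?thesis using K.acts_as_scalar_imp_eq[OF c] by simp
qed

lemma act_closed [simp]:
  "\<lbrakk>a \<in> carrier A; x \<in> carrier (K i)\<rbrakk> \<Longrightarrow> \<phi> i a x \<in> carrier (K i)"
  by (rule act.element_image[OF _ _ refl])

lemma act_mult:
  "\<lbrakk>a \<in> carrier A; b \<in> carrier A; x \<in> carrier (K i)\<rbrakk> \<Longrightarrow> \<phi> i (a \<otimes> b) x = \<phi> i a (\<phi> i b x)"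
  by (rule act.composition_rule)

lemma act_one [simp]: "x \<in> carrier (K i) \<Longrightarrow> \<phi> i \<one> x = x"
  using act.id_eq_one by (metis restrict_apply')

lemma act_add:
  "\<lbrakk>a \<in> carrier A; x \<in> carrier (K i); y \<in> carrier (K i)\<rbrakk> \<Longrightarrow>
    \<phi> i a (x \<oplus>\<^bsub>K i\<^esub> y) = \<phi> i a x \<oplus>\<^bsub>K i\<^esub> \<phi> i a y"
  using act_eq_mult[of a "x \<oplus>\<^bsub>K i\<^esub> y"] act_eq_mult[of a x] act_eq_mult[of a y]
  by (simp add: K.r_distr)

lemma act_zero [simp]: "a \<in> carrier A \<Longrightarrow> \<phi> i a \<zero>\<^bsub>K i\<^esub> = \<zero>\<^bsub>K i\<^esub>"
  using act_eq_mult[of a "\<zero>\<^bsub>K i\<^esub>"] by simp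

lemma nrm_act:
  "\<lbrakk>a \<in> carrier A; x \<in> carrier (K i)\<rbrakk> \<Longrightarrow>
    nrm i (\<phi> i a x) = nrm i (\<phi> i a \<one>\<^bsub>K i\<^esub>) * nrm i x"
  using act_eq_mult[of a x] K.nrm_mult[of "\<phi> i a \<one>\<^bsub>K i\<^esub>" x] by simp

lemma nrm_act_pow:
  assumes "a \<in> carrier A" "x \<in> carrier (K i)"
  shows "nrm i (\<phi> i (a [^] (n::nat)) x) = nrm i (\<phi> i a \<one>\<^bsub>K i\<^esub>) ^ n * nrm i x"
proof (induction n)
  case (Suc n)
  have "nrm i (\<phi> i (a \<otimes> a [^] n) x) = nrm i (\<phi> i a \<one>\<^bsub>K i\<^esub>) * nrm i (\<phi> i (a [^] n) x)"
    using assms by (simp add: act_mult nrm_act[of a "\<phi> i (a [^] n) x"])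
  then show ?case using Suc assms by (simp flip: nat_pow_Suc2 del: nat_pow_Suc)
qed (use assms in simp)

text \<open>The exponent needed to bring \<open>x\<close> into the unit ball grows only linearly in
  \<open>n\<close>, because its norm is bounded exponentially and powers of a contraction shrink
  exponentially. The point is that \<open>D\<close> is chosen before \<open>n\<close> and
  \<open>x\<close>.\<close>

lemma contraction_reaches_unit_ball:
  assumes a: "a \<in> carrier A" "nrm i (\<phi> i a \<one>\<^bsub>K i\<^esub>) < 1"
    and T: "T \<subseteq> carrier A" "\<And>s. s \<in> T \<Longrightarrow> inv s \<in> T" "generate A T = carrier A"
    and M: "0 < M"
  obtains D :: nat where
    "\<And>n x. \<lbrakk>x \<in> carrier (K i); nrm i x \<le> M ^ n\<rbrakk> \<Longrightarrow>
       \<exists>u v. u \<in> lists T \<and> v \<in> unit_ball (K i) (nrm i) \<and>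
         \<phi> i (word_eval A u) v = x \<and> length u \<le> D * n"
proof -
  define q where "q = nrm i (\<phi> i a \<one>\<^bsub>K i\<^esub>)"
  have q: "0 \<le> q" "q < 1" using a by (auto simp: q_def K.nrm_nonneg)
  \<comment> \<open>One \<open>k\<close> compensates one factor \<open>M\<close>. It depends only on
    \<open>q\<close> and \<open>M\<close>, so it serves all \<open>n\<close>.\<close>
  obtain k where "q ^ k < 1 / M"
    using real_arch_pow_inv[of "1 / M" q] q M by auto
  then have qk: "q ^ k * M \<le> 1" using M by (simp add: field_simps)
  \<comment> \<open>The word must undo the contraction, hence it spells \<open>inv a\<close> rather
    than \<open>a\<close>.\<close>
  obtain y where y: "y \<in> lists T" "word_eval A y = inv a"
    using generate_word_eval[of T "inv a"] T a by auto
  then have yA: "set y \<subseteq> carrier A" using T by auto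
  show thesis
  proof (rule that)
    fix n x assume x: "x \<in> carrier (K i)" "nrm i x \<le> M ^ n"
    \<comment> \<open>The vector \<open>v\<close> is \<open>x\<close> pushed into the unit ball by
      \<open>k * n\<close> contractions, and \<open>u\<close> is the word that carries it
      back.\<close>
    define u where "u = concat (replicate (k * n) y)"
    define v where "v = \<phi> i (a [^] (k * n)) x"
    have "nrm i v = (q ^ k) ^ n * nrm i x"
      using nrm_act_pow[of a x "k * n"] a x by (simp add: v_def q_def power_mult)
    also have "\<dots> \<le> (q ^ k) ^ n * M ^ n"
      using x q by (intro mult_left_mono) auto
    also have "\<dots> = (q ^ k * M) ^ n" by (simp add: power_mult_distrib)
    also have "\<dots> \<le> 1" using qk q M by (intro power_le_one) auto
    finally have v: "v \<in> unit_ball (K i) (nrm i)"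
      using a x by (simp add: unit_ball_def v_def)
    have "word_eval A u = inv a [^] (k * n)"
      unfolding u_def using yA y a
      by (subst word_eval_concat) (auto simp: word_eval_replicate)
    then have "\<phi> i (word_eval A u) v = \<phi> i (inv a [^] (k * n) \<otimes> a [^] (k * n)) x"
      using a x by (simp add: v_def act_mult)
    also have "inv a [^] (k * n) \<otimes> a [^] (k * n) = \<one>"
      using a by (simp add: nat_pow_inv)
    finally have "\<phi> i (word_eval A u) v = x" using x by simp
    moreover have "u \<in> lists T" using y by (auto simp: u_def)
    \<comment> \<open>This fixes \<open>D\<close> as \<open>length y * k\<close>.\<close>
    moreover have "length u = length y * k * n"
      by (simp add: u_def length_concat sum_list_replicate)
    ultimately show "\<exists>u v. u \<in> lists T \<and> v \<in> unit_ball (K i) (nrm i) \<and>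
         \<phi> i (word_eval A u) v = x \<and> length u \<le> length y * k * n"
      using v by (metis order_refl)
  qed
qed

end

section \<open>The direct sum of the fields and its semidirect product with \<open>A\<close>\<close>

lemma carrier_N: "carrier N = (\<Pi>\<^sub>E i\<in>{1..m}. carrier (K i))"
  \<comment> \<open>The index set is finite, so the finite-support condition of the direct sum is
    automatic and the full extensional product remains.\<close>
  unfolding field_sum_def using group_add_K by (subst carrier_sum_group) auto

lemma one_N: "\<one>\<^bsub>N\<^esub> = (\<lambda>i\<in>{1..m}. \<zero>\<^bsub>K i\<^esub>)"
  by (simp add: field_sum_def)

lemma mult_N: "x \<otimes>\<^bsub>N\<^esub> y = (\<lambda>i\<in>{1..m}. x i \<oplus>\<^bsub>K i\<^esub> y i)"
  by (simp add: field_sum_def)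

lemma group_N: "group N"
  unfolding field_sum_def using group_add_K by (intro sum_group) auto

lemma sum_action_closed:
  "\<lbrakk>a \<in> carrier A; x \<in> carrier N\<rbrakk> \<Longrightarrow> sum_action m \<phi> a x \<in> carrier N"
  by (auto simp: carrier_N sum_action_def PiE_iff)

lemma sum_action_mult:
  "\<lbrakk>a \<in> carrier A; b \<in> carrier A; x \<in> carrier N\<rbrakk> \<Longrightarrow>
    sum_action m \<phi> (a \<otimes> b) x = sum_action m \<phi> a (sum_action m \<phi> b x)"
  by (auto simp: carrier_N sum_action_def PiE_iff act_mult)

lemma sum_action_one: "x \<in> carrier N \<Longrightarrow> sum_action m \<phi> \<one> x = x"
  by (rule extensionalityI[of _ "{1..m}"]) (auto simp: carrier_N sum_action_def PiE_iff)

lemma sum_action_add: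
  "\<lbrakk>a \<in> carrier A; x \<in> carrier N; y \<in> carrier N\<rbrakk> \<Longrightarrow>
    sum_action m \<phi> a (x \<otimes>\<^bsub>N\<^esub> y) = sum_action m \<phi> a x \<otimes>\<^bsub>N\<^esub> sum_action m \<phi> a y"
  unfolding sum_action_def mult_N by (rule restrict_ext) (simp add: carrier_N PiE_iff act_add)

text \<open>The coordinatewise action of \<open>inv a\<close> is a two-sided inverse of that of
  \<open>a\<close>, so each \<open>a\<close> permutes the carrier, as membership in
  \<open>BijGroup\<close> demands.\<close>

lemma group_action_sum_action:
  "group_action A (carrier N) (\<lambda>a. \<lambda>x\<in>carrier N. sum_action m \<phi> a x)"
proof -
  have inverse: "sum_action m \<phi> (inv a) (sum_action m \<phi> a x) = x"
      "sum_action m \<phi> a (sum_action m \<phi> (inv a) x) = x"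
    if "a \<in> carrier A" "x \<in> carrier N" for a x
    using that by (simp_all flip: sum_action_mult add: sum_action_one)
  have "bij_betw (\<lambda>x\<in>carrier N. sum_action m \<phi> a x) (carrier N) (carrier N)"
    if "a \<in> carrier A" for a
    by (rule bij_betw_byWitness[where f' = "sum_action m \<phi> (inv a)"])
      (use that in \<open>auto simp: inverse sum_action_closed\<close>)
  then have "(\<lambda>a. \<lambda>x\<in>carrier N. sum_action m \<phi> a x) \<in> hom A (BijGroup (carrier N))"
    by (auto simp: hom_def BijGroup_def Bij_def compose_def sum_action_mult sum_action_closed)
  then show ?thesis
    by (intro group_action.intro group_hom.intro group_hom_axioms.intro group_BijGroup is_group)
qed

lemma group_G: "group G"
  unfolding field_semidirect_def
proof (rule group_semidirect_product[OF group_N group_action_sum_action])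
  fix a assume "a \<in> carrier A"
  then show "(\<lambda>x\<in>carrier N. sum_action m \<phi> a x) \<in> hom N N"
    using monoid.m_closed[OF group.is_monoid[OF group_N]] sum_action_add
    by (simp add: hom_def sum_action_closed)
qed

lemma carrier_G: "carrier G = carrier N \<times> carrier A"
  by (simp add: field_semidirect_def semidirect_product_def)

lemma one_G: "\<one>\<^bsub>G\<^esub> = (\<one>\<^bsub>N\<^esub>, \<one>)"
  by (simp add: field_semidirect_def semidirect_product_def)

lemma mult_G:
  "y \<in> carrier N \<Longrightarrow> (x, a) \<otimes>\<^bsub>G\<^esub> (y, b) =
    ((\<lambda>i\<in>{1..m}. x i \<oplus>\<^bsub>K i\<^esub> \<phi> i a (y i)), a \<otimes> b)"
  by (auto simp: field_semidirect_def semidirect_product_def mult_N sum_action_def)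

lemma zero_K_closed: "i \<in> {1..m} \<Longrightarrow> \<zero>\<^bsub>K i\<^esub> \<in> carrier (K i)"
  by (rule ring.ring_simprules(2)[OF ring_K])

lemma add_zero_K:
  assumes "i \<in> {1..m}" "x \<in> carrier (K i)"
  shows "\<zero>\<^bsub>K i\<^esub> \<oplus>\<^bsub>K i\<^esub> x = x" "x \<oplus>\<^bsub>K i\<^esub> \<zero>\<^bsub>K i\<^esub> = x"
proof -
  interpret ring "K i" using ring_K assms by blast
  show "\<zero>\<^bsub>K i\<^esub> \<oplus>\<^bsub>K i\<^esub> x = x" "x \<oplus>\<^bsub>K i\<^esub> \<zero>\<^bsub>K i\<^esub> = x" using assms by auto
qed

lemma one_N_closed: "(\<lambda>i\<in>{1..m}. \<zero>\<^bsub>K i\<^esub>) \<in> carrier N"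
  using zero_K_closed by (auto simp: carrier_N)

section \<open>Evaluation of normal-form words in the semidirect product\<close>

lemma emb_group_closed: "a \<in> carrier A \<Longrightarrow> emb_group m K a \<in> carrier G"
  using one_N_closed by (simp add: emb_group_def carrier_G one_N)

lemma emb_closed: "v \<in> carrier (K i) \<Longrightarrow> emb i v \<in> carrier G"
  using zero_K_closed by (auto simp: emb_field_def carrier_G carrier_N)

lemma emb_group_mult:
  "\<lbrakk>a \<in> carrier A; b \<in> carrier A\<rbrakk> \<Longrightarrow>
    emb_group m K a \<otimes>\<^bsub>G\<^esub> emb_group m K b = emb_group m K (a \<otimes> b)"
  using one_N_closed
  by (auto simp: emb_group_def one_N mult_G add_zero_K zero_K_closed)

lemma word_eval_emb_group:
  "set t \<subseteq> carrier A \<Longrightarrow>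
    word_eval G (map (emb_group m K) t) = emb_group m K (word_eval A t)"
  by (induction t) (auto simp: emb_group_mult, simp add: emb_group_def one_G)

lemma inv_emb_group:
  assumes "a \<in> carrier A"
  shows "inv\<^bsub>G\<^esub> emb_group m K a = emb_group m K (inv a)"
  using assms
  by (intro group.inv_equality[OF group_G])
    (auto simp: emb_group_mult emb_group_closed, simp add: emb_group_def one_G)

text \<open>The two \<open>A\<close>-components cancel, and the outer factors have zero field part,
  so what remains is the action of \<open>a\<close> on the embedded vector. The other coordinates
  stay zero because scalars fix zero.\<close>

lemma emb_group_conj:
  assumes "i \<in> {1..m}" "a \<in> carrier A" "v \<in> carrier (K i)"
  shows "emb_group m K a \<otimes>\<^bsub>G\<^esub> emb i v \<otimes>\<^bsub>G\<^esub> inv\<^bsub>G\<^esub> (emb_group m K a) = emb i (\<phi> i a v)"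
proof -
  have "(\<lambda>j\<in>{1..m}. if j = i then v else \<zero>\<^bsub>K j\<^esub>) \<in> carrier N"
    using assms zero_K_closed by (auto simp: carrier_N)
  moreover note one_N_closed
  ultimately show ?thesis using assms
    by (auto simp: inv_emb_group, auto simp: emb_group_def emb_field_def one_N mult_G add_zero_K zero_K_closed
        intro!: restrict_ext)
qed

lemma word_eval_conj:
  assumes "i \<in> {1..m}" "set t \<subseteq> carrier A" "v \<in> carrier (K i)"
  defines "u \<equiv> map (emb_group m K) t"
  shows "word_eval G (u @ [emb i v] @ word_inv G u) = emb i (\<phi> i (word_eval A t) v)"
proof -
  interpret G: group G by (rule group_G)
  have u: "set u \<subseteq> carrier G" using assms emb_group_closed by auto
  have "word_eval G (u @ [emb i v] @ word_inv G u) =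
      emb_group m K (word_eval A t) \<otimes>\<^bsub>G\<^esub> emb i v \<otimes>\<^bsub>G\<^esub> inv\<^bsub>G\<^esub> (emb_group m K (word_eval A t))"
    using u G.word_inv_closed[OF u] emb_closed[OF assms(3)] emb_group_closed assms(2)
    by (simp add: G.word_eval_append G.word_eval_word_inv G.m_assoc)
      (simp add: u_def word_eval_emb_group G.m_assoc)
  then show ?thesis using assms by (simp add: emb_group_conj)
qed

text \<open>Truncation at \<open>k\<close> makes the induction possible: the partial product has
  trivial \<open>A\<close>-component, so multiplying on the right by the next embedded vector simply
  fills in one more coordinate.\<close>

lemma word_eval_components:
  assumes x: "x \<in> carrier N" and "k \<le> m"
  shows "word_eval G (map (\<lambda>i. emb i (x i)) [1..<Suc k]) =
    ((\<lambda>i\<in>{1..m}. if i \<le> k then x i else \<zero>\<^bsub>K i\<^esub>), \<one>)"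
  using assms(2)
proof (induction k)
  case 0
  then show ?case by (auto simp: one_G one_N)
next
  case (Suc k)
  interpret G: group G by (rule group_G)
  have xK: "x i \<in> carrier (K i)" if "i \<in> {1..m}" for i using x that by (auto simp: carrier_N)
  have c: "emb i (x i) \<in> carrier G" if "i \<in> {1..m}" for i using xK that emb_closed by blast
  have "word_eval G (map (\<lambda>i. emb i (x i)) [1..<Suc (Suc k)]) =
      word_eval G (map (\<lambda>i. emb i (x i)) [1..<Suc k]) \<otimes>\<^bsub>G\<^esub> emb (Suc k) (x (Suc k))"
    using c Suc.prems
    by (subst upt_Suc_append) (auto simp: G.word_eval_append subset_eq simp del: upt_Suc)
  also have "\<dots> = ((\<lambda>i\<in>{1..m}. if i \<le> k then x i else \<zero>\<^bsub>K i\<^esub>), \<one>) \<otimes>\<^bsub>G\<^esub> emb (Suc k) (x (Suc k))"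
    by (simp only: Suc.IH[OF Suc_leD[OF Suc.prems]])
  also have "\<dots> = ((\<lambda>i\<in>{1..m}. if i \<le> Suc k then x i else \<zero>\<^bsub>K i\<^esub>), \<one>)"
  proof -
    have "(\<lambda>j\<in>{1..m}. if j = Suc k then x (Suc k) else \<zero>\<^bsub>K j\<^esub>) \<in> carrier N"
      using xK Suc.prems zero_K_closed by (auto simp: carrier_N)
    then show ?thesis
      using xK Suc.prems
      by (auto simp: emb_field_def mult_G add_zero_K zero_K_closed intro!: restrict_ext)
  qed
  finally show ?case .
qed

text \<open>Each conjugate contributes exactly one coordinate of \<open>x\<close>, together they
  give \<open>x\<close> with trivial \<open>A\<close>-component, and the final word supplies that
  component.\<close>

lemma word_eval_normal_word:
  assumes x: "x \<in> carrier N" and t: "set t \<subseteq> carrier A"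
    and u: "\<And>i. i \<in> {1..m} \<Longrightarrow> set (u i) \<subseteq> carrier A"
    and v: "\<And>i. i \<in> {1..m} \<Longrightarrow> v i \<in> carrier (K i)"
    and uv: "\<And>i. i \<in> {1..m} \<Longrightarrow> \<phi> i (word_eval A (u i)) (v i) = x i"
  shows "word_eval G (concat (map (\<lambda>i. map (emb_group m K) (u i) @ [emb i (v i)] @
            word_inv G (map (emb_group m K) (u i))) [1..<Suc m]) @ map (emb_group m K) t) =
    (x, word_eval A t)"
proof -
  interpret G: group G by (rule group_G)
  let ?c = "\<lambda>i. map (emb_group m K) (u i) @ [emb i (v i)] @ word_inv G (map (emb_group m K) (u i))"
  have c: "set (?c i) \<subseteq> carrier G" if i: "i \<in> {1..m}" for i
  proof -
    have e: "set (map (emb_group m K) (u i)) \<subseteq> carrier G"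
      using u[OF i] emb_group_closed by auto
    then show ?thesis using G.word_inv_closed[OF e] emb_closed[OF v[OF i]] by simp
  qed
  have "word_eval G (concat (map ?c [1..<Suc m])) =
      word_eval G (map (word_eval G) (map ?c [1..<Suc m]))"
    by (rule G.word_eval_concat) (use c in force)
  also have "map (word_eval G) (map ?c [1..<Suc m]) = map (\<lambda>i. emb i (x i)) [1..<Suc m]"
    unfolding map_map o_def
  proof (rule map_cong[OF refl])
    fix i assume "i \<in> set [1..<Suc m]"
    then have "i \<in> {1..m}" by auto
    then show "word_eval G (?c i) = emb i (x i)"
      using word_eval_conj[of i "u i" "v i"] u v uv by simp
  qed
  also have "word_eval G \<dots> = (x, \<one>)"
  proof -
    \<comment> \<open>At \<open>k = m\<close> the truncation is vacuous, and both sides are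
      undefined outside the index range.\<close>
    have "(\<lambda>i\<in>{1..m}. if i \<le> m then x i else \<zero>\<^bsub>K i\<^esub>) = x"
      using x by (intro extensionalityI[of _ "{1..m}"]) (auto simp: carrier_N PiE_iff)
    then show ?thesis using word_eval_components[OF x order_refl] by simp
  qed
  finally have "word_eval G (concat (map ?c [1..<Suc m])) = (x, \<one>)" .
  moreover have "set (concat (map ?c [1..<Suc m])) \<subseteq> carrier G"
    using c by force
  moreover have "set (map (emb_group m K) t) \<subseteq> carrier G"
    using t emb_group_closed by auto
  ultimately have "word_eval G (concat (map ?c [1..<Suc m]) @ map (emb_group m K) t) =
      (x, \<one>) \<otimes>\<^bsub>G\<^esub> emb_group m K (word_eval A t)"
    using t by (simp only: G.word_eval_append word_eval_emb_group)
  also have "\<dots> = (x, word_eval A t)"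
  proof -
    \<comment> \<open>The trailing word has zero field part, so it leaves \<open>x\<close>
      unchanged.\<close>
    have "(\<lambda>i\<in>{1..m}. x i \<oplus>\<^bsub>K i\<^esub> \<phi> i \<one> \<zero>\<^bsub>K i\<^esub>) = x"
      using x by (intro extensionalityI[of _ "{1..m}"]) (auto simp: carrier_N PiE_iff add_zero_K)
    then show ?thesis using t one_N_closed
      by (simp add: emb_group_def one_N mult_G cong: restrict_cong)
  qed
  finally show ?thesis .
qed

section \<open>Exponential bound on the field components of a word\<close>

lemma word_eval_bound:
  assumes T: "T \<subseteq> carrier A"
    and M: "2 \<le> M" "\<And>i s. \<lbrakk>i \<in> {1..m}; s \<in> T\<rbrakk> \<Longrightarrow> nrm i (\<phi> i s \<one>\<^bsub>K i\<^esub>) \<le> M"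
    and w: "w \<in> lists (gen_set m K nrm A T)"
  shows "\<exists>x t. word_eval G w = (x, word_eval A t) \<and> x \<in> carrier N \<and> t \<in> lists T \<and>
    length t \<le> length w \<and> (\<forall>i\<in>{1..m}. nrm i (x i) \<le> M ^ length w)"
  using w
proof (induction w)
  case Nil
  \<comment> \<open>For the empty word the bound is \<open>M ^ 0 = 1\<close>.\<close>
  have "nrm i (\<one>\<^bsub>N\<^esub> i) \<le> 1" if "i \<in> {1..m}" for i
    using multiplicative_norm.nrm_zero[OF multiplicative_norm[OF that]] that by (simp add: one_N)
  then show ?case
    using monoid.one_closed[OF group.is_monoid[OF group_N]]
    by (intro exI[of _ "\<one>\<^bsub>N\<^esub>"] exI[of _ "[]"]) (simp add: one_G)
next
  case (Cons g w)
  from Cons.IH obtain x t where IH: "word_eval G w = (x, word_eval A t)" "x \<in> carrier N"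
    "t \<in> lists T" "length t \<le> length w" "\<forall>i\<in>{1..m}. nrm i (x i) \<le> M ^ length w"
    by (elim exE conjE)
  have xK: "x i \<in> carrier (K i)" if "i \<in> {1..m}" for i using IH(2) that by (auto simp: carrier_N)
  have tA: "word_eval A t \<in> carrier A" using IH(3) T by (intro word_eval_closed) auto
  \<comment> \<open>The two kinds may overlap: if the identity of \<open>A\<close> lies in
    \<open>T\<close>, its embedding is also an embedded zero vector. Either reading of the letter
    works, which is why \<open>t\<close> is only claimed to exist.\<close>
  from Cons.hyps consider s where "s \<in> T" "g = emb_group m K s"
    | j v where "j \<in> {1..m}" "v \<in> unit_ball (K j) (nrm j)" "g = emb j v"
    by (auto simp: gen_set_def)
  then show ?case
  proof cases
    case 1
    then have s: "s \<in> carrier A" using T by auto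
    \<comment> \<open>A letter from \<open>T\<close> stands to the left of the remaining word and
      therefore acts on its whole field part.\<close>
    let ?x = "\<lambda>i\<in>{1..m}. \<phi> i s (x i)"
    have "word_eval G (g # w) = (?x, word_eval A (s # t))"
      using 1 IH(1,2) s xK by (auto simp: emb_group_def one_N mult_G add_zero_K)
    moreover have "?x \<in> carrier N" using xK s by (auto simp: carrier_N)
    moreover have "nrm i (?x i) \<le> M ^ length (g # w)" if i: "i \<in> {1..m}" for i
    proof -
      interpret K: multiplicative_norm "K i" "nrm i" by (rule multiplicative_norm[OF i])
      have "nrm i (\<phi> i s (x i)) = nrm i (\<phi> i s \<one>\<^bsub>K i\<^esub>) * nrm i (x i)"
        by (rule nrm_act[OF i s xK[OF i]])
      also have "\<dots> \<le> M * M ^ length w"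
        using M 1 i bspec[OF IH(5) i] xK[OF i] by (intro mult_mono) (auto simp: K.nrm_nonneg)
      finally show ?thesis using i by simp
    qed
    moreover have "s # t \<in> lists T" "length (s # t) \<le> length (g # w)" using 1 IH by auto
    ultimately show ?thesis by blast
  next
    case 2
    \<comment> \<open>A letter from a unit ball has trivial \<open>A\<close>-component, so it
      translates the field part without scaling it, and only in coordinate \<open>j\<close>.\<close>
    let ?x = "\<lambda>i\<in>{1..m}. (if i = j then v else \<zero>\<^bsub>K i\<^esub>) \<oplus>\<^bsub>K i\<^esub> x i"
    have vK: "(if i = j then v else \<zero>\<^bsub>K i\<^esub>) \<in> carrier (K i)" if "i \<in> {1..m}" for i
      using 2 that zero_K_closed by (auto simp: unit_ball_def)
    have "word_eval G (g # w) = (?x, word_eval A t)"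
      using 2 IH(1,2) xK tA by (auto simp: emb_field_def mult_G)
    moreover have "?x \<in> carrier N"
    proof -
      have "(if i = j then v else \<zero>\<^bsub>K i\<^esub>) \<oplus>\<^bsub>K i\<^esub> x i \<in> carrier (K i)" if "i \<in> {1..m}" for i
        using ring.ring_simprules(1)[OF ring_K[OF that] vK[OF that] xK[OF that]] .
      then show ?thesis by (auto simp: carrier_N)
    qed
    moreover have "nrm i (?x i) \<le> M ^ length (g # w)" if i: "i \<in> {1..m}" for i
    proof -
      interpret K: multiplicative_norm "K i" "nrm i" by (rule multiplicative_norm[OF i])
      have "nrm i (if i = j then v else \<zero>\<^bsub>K i\<^esub>) \<le> 1"
        using 2 by (auto simp: unit_ball_def)
      then have "nrm i (?x i) \<le> 1 + M ^ length w"
        using K.nrm_triangle[OF vK[OF i] xK[OF i]] bspec[OF IH(5) i] i by simp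
      \<comment> \<open>The added 1 is absorbed because \<open>M ^ length w\<close> is at least 1;
        the resulting factor 2 is absorbed next by \<open>2 \<le> M\<close>.\<close>
      also have "\<dots> \<le> 2 * M ^ length w" using M(1) by simp
      also have "\<dots> \<le> M ^ length (g # w)" using M(1) by simp
      finally show ?thesis .
    qed
    moreover have "length t \<le> length (g # w)" using IH by auto
    ultimately show ?thesis using IH(3) by blast
  qed
qed

text \<open>The inverse words are the only delicate part: their letters are inverses in
  \<open>G\<close> of embedded elements of \<open>T\<close>, and these are again embedded elements
  of \<open>T\<close> by symmetry.\<close>

lemma normal_words_subset:
  assumes T: "T \<subseteq> carrier A" "\<And>s. s \<in> T \<Longrightarrow> inv s \<in> T"
  shows "normal_words m K nrm A \<phi> T \<subseteq> lists (gen_set m K nrm A T)"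
proof -
  have "word_inv G u \<in> lists (emb_group m K ` T)" if "u \<in> lists (emb_group m K ` T)" for u
  proof -
    have "inv\<^bsub>G\<^esub> g \<in> emb_group m K ` T" if g: "g \<in> emb_group m K ` T" for g
    proof -
      obtain s where s: "s \<in> T" "g = emb_group m K s" using g by blast
      then show ?thesis using T inv_emb_group[of s] by auto
    qed
    then show ?thesis using that by (auto simp: word_inv_def)
  qed
  then have letters: "set (word_inv G u) \<subseteq> gen_set m K nrm A T" "set u \<subseteq> gen_set m K nrm A T"
    if "u \<in> lists (emb_group m K ` T)" for u
    using that by (auto simp: gen_set_def)
  have ball: "emb i v \<in> gen_set m K nrm A T"
    if "i \<in> {1..m}" "v \<in> unit_ball (K i) (nrm i)" for i v
    using that by (auto simp: gen_set_def)
  show ?thesis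
  proof
    fix w assume "w \<in> normal_words m K nrm A \<phi> T"
    then obtain u v t where
      w: "w = concat (map (\<lambda>i. u i @ [emb i (v i)] @ word_inv G (u i)) [1..<Suc m]) @ t"
      and uv: "\<forall>i \<in> {1..m}. u i \<in> lists (emb_group m K ` T) \<and> v i \<in> unit_ball (K i) (nrm i)"
      and t: "t \<in> lists (emb_group m K ` T)"
      unfolding normal_words_def mem_Collect_eq by (elim exE conjE)
    have "set (u i @ [emb i (v i)] @ word_inv G (u i)) \<subseteq> gen_set m K nrm A T"
      if "i \<in> {1..m}" for i
      using letters[of "u i"] ball[of i "v i"] uv that by simp
    then have "set (concat (map (\<lambda>i. u i @ [emb i (v i)] @ word_inv G (u i)) [1..<Suc m]))
        \<subseteq> gen_set m K nrm A T"
      unfolding set_concat set_map set_upt atLeastLessThanSuc_atLeastAtMost image_image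
      by (rule UN_least)
    then show "w \<in> lists (gen_set m K nrm A T)"
      using letters(2)[OF t] by (simp add: w lists_eq_set)
  qed
qed

end

section \<open>Combination of the two estimates into a linear length bound\<close>

theorem lemma5p1:
  fixes A :: "('a, 'b) monoid_scheme"
    and m :: nat
    and K :: "nat \<Rightarrow> ('k, 'r) ring_scheme"
    and nrm :: "nat \<Rightarrow> 'k \<Rightarrow> real"
    and \<phi> :: "nat \<Rightarrow> 'a \<Rightarrow> 'k \<Rightarrow> 'k"
    and T :: "'a set"
  assumes "comm_group A"
    and "\<And>i. i \<in> {1..m} \<Longrightarrow> local_field (K i) (nrm i)"
    and "\<And>i. i \<in> {1..m} \<Longrightarrow> scalar_action A (K i) (\<phi> i)"
    and "\<And>i. i \<in> {1..m} \<Longrightarrow>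
           \<exists>a \<in> carrier A. \<exists>c. acts_as_scalar (K i) (\<phi> i a) c \<and> nrm i c < 1"
    and "finite T" and "T \<subseteq> carrier A"
    and "\<And>s. s \<in> T \<Longrightarrow> inv\<^bsub>A\<^esub> s \<in> T"
    and "generate A T = carrier A"
  shows "efficient (field_semidirect m K A \<phi>) (gen_set m K nrm A T) (normal_words m K nrm A \<phi> T)"
proof -
  interpret A: comm_group A by fact
  interpret scalar_semidirect A m K nrm \<phi>
    by (intro scalar_semidirect.intro scalar_semidirect_axioms.intro assms(1,3)
        local_field.axioms(1)[OF assms(2)])
  \<comment> \<open>Inserting 2 provides \<open>2 \<le> M\<close> and keeps the maximum defined when
    \<open>m = 0\<close> or \<open>T\<close> is empty.\<close>
  define M where "M = Max (insert 2 ((\<lambda>(i, s). nrm i (\<phi> i s \<one>\<^bsub>K i\<^esub>)) ` ({1..m} \<times> T)))"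
  have fin: "finite ((\<lambda>(i, s). nrm i (\<phi> i s \<one>\<^bsub>K i\<^esub>)) ` ({1..m} \<times> T))"
    using assms(5) by simp
  have M: "2 \<le> M" "\<And>i s. \<lbrakk>i \<in> {1..m}; s \<in> T\<rbrakk> \<Longrightarrow> nrm i (\<phi> i s \<one>\<^bsub>K i\<^esub>) \<le> M"
    unfolding M_def using fin by (auto intro!: Max_ge)
  have "\<exists>D::nat. \<forall>n x. x \<in> carrier (K i) \<and> nrm i x \<le> M ^ n \<longrightarrow>
      (\<exists>u v. u \<in> lists T \<and> v \<in> unit_ball (K i) (nrm i) \<and>
        \<phi> i (word_eval A u) v = x \<and> length u \<le> D * n)" if i: "i \<in> {1..m}" for i
  proof -
    obtain a c where a: "a \<in> carrier A" "acts_as_scalar (K i) (\<phi> i a) c" "nrm i c < 1"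
      using assms(4)[OF i] by blast
    then have "nrm i (\<phi> i a \<one>\<^bsub>K i\<^esub>) < 1"
      using multiplicative_norm.acts_as_scalar_imp_eq[OF multiplicative_norm[OF i]] by blast
    then show ?thesis
      using contraction_reaches_unit_ball[OF i a(1) _ assms(6-8), of M] M(1)
      by (metis less_le_trans zero_less_numeral)
  qed
  \<comment> \<open>The constants are chosen per field, before any word is considered, so they are
    uniform in \<open>w\<close>.\<close>
  then obtain D :: "nat \<Rightarrow> nat" where D: "\<And>i n x. \<lbrakk>i \<in> {1..m}; x \<in> carrier (K i); nrm i x \<le> M ^ n\<rbrakk> \<Longrightarrow>
      \<exists>u v. u \<in> lists T \<and> v \<in> unit_ball (K i) (nrm i) \<and>
        \<phi> i (word_eval A u) v = x \<and> length u \<le> D i * n"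
    by metis
  \<comment> \<open>In units of \<open>length w\<close>, each conjugate costs \<open>2 * D i\<close>
    for the conjugating word and its inverse and 1 for the ball letter; the last 1 pays for
    \<open>t\<close>.\<close>
  define C where "C = (\<Sum>i=1..m. 2 * D i + 1) + 1"
  have "\<exists>w' \<in> normal_words m K nrm A \<phi> T. word_eval G w' = word_eval G w \<and>
      real (length w') \<le> real C * real (length w)"
    if w: "w \<in> lists (gen_set m K nrm A T)" "w \<noteq> []" for w
  proof -
    \<comment> \<open>The same \<open>?n\<close> bounds the length of \<open>t\<close> and is the
      exponent in the norm bound, so it feeds directly into the contraction estimate.\<close>
    let ?n = "length w"
    obtain x t where xt: "word_eval G w = (x, word_eval A t)" "x \<in> carrier N" "t \<in> lists T"
      "length t \<le> ?n" "\<And>i. i \<in> {1..m} \<Longrightarrow> nrm i (x i) \<le> M ^ ?n"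
      using word_eval_bound[OF assms(6) M w(1)] by blast
    have "\<exists>u v. u \<in> lists T \<and> v \<in> unit_ball (K i) (nrm i) \<and>
        \<phi> i (word_eval A u) v = x i \<and> length u \<le> D i * ?n" if "i \<in> {1..m}" for i
    proof (rule D[OF that _ xt(5)[OF that]])
      show "x i \<in> carrier (K i)" using xt(2) that by (auto simp: carrier_N)
    qed
    then obtain u v where uv: "\<And>i. i \<in> {1..m} \<Longrightarrow> u i \<in> lists T"
      "\<And>i. i \<in> {1..m} \<Longrightarrow> v i \<in> unit_ball (K i) (nrm i)"
      "\<And>i. i \<in> {1..m} \<Longrightarrow> \<phi> i (word_eval A (u i)) (v i) = x i"
      "\<And>i. i \<in> {1..m} \<Longrightarrow> length (u i) \<le> D i * ?n"
      by metis
    let ?u = "\<lambda>i. map (emb_group m K) (u i)"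
    define w' where "w' = concat (map (\<lambda>i. ?u i @ [emb i (v i)] @ word_inv G (?u i)) [1..<Suc m]) @
      map (emb_group m K) t"
    have "w' \<in> normal_words m K nrm A \<phi> T"
      unfolding normal_words_def w'_def mem_Collect_eq
      by (rule exI[of _ ?u], rule exI[of _ v], rule exI[of _ "map (emb_group m K) t"])
         (use uv(1,2) xt(3) in \<open>fastforce simp: in_lists_conv_set\<close>)
    moreover have "word_eval G w' = word_eval G w"
      unfolding w'_def xt(1)
    proof (rule word_eval_normal_word[OF xt(2)])
      show "set t \<subseteq> carrier A" using xt(3) assms(6) by auto
      show "set (u i) \<subseteq> carrier A" if "i \<in> {1..m}" for i using uv(1)[OF that] assms(6) by auto
      show "v i \<in> carrier (K i)" if "i \<in> {1..m}" for i using uv(2)[OF that] by (simp add: unit_ball_def)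
    qed (rule uv(3))
    moreover have "length w' \<le> C * ?n"
    proof -
      have "length w' = (\<Sum>i=1..m. 2 * length (u i) + 1) + length t"
        by (simp add: w'_def length_concat word_inv_def o_def interv_sum_list_conv_sum_set_nat
            atLeastLessThanSuc_atLeastAtMost mult_2 del: upt_Suc)
      also have "\<dots> \<le> (\<Sum>i=1..m. (2 * D i + 1) * ?n) + ?n"
      proof (intro add_mono sum_mono xt(4))
        fix i assume "i \<in> {1..m}"
        then have "length (u i) \<le> D i * ?n" by (rule uv(4))
        \<comment> \<open>A normal-form word always contains its \<open>m\<close> ball letters, even
          where the component is zero. Nonemptiness of \<open>w\<close> lets each of them be charged
          to \<open>?n\<close>.\<close>
        moreover have "1 \<le> ?n" using w(2) by (simp add: Suc_le_eq)
        ultimately show "2 * length (u i) + 1 \<le> (2 * D i + 1) * ?n"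
          by (simp add: algebra_simps)
      qed
      also have "\<dots> = C * ?n" by (simp only: C_def sum_distrib_right add_mult_distrib mult_1)
      finally show ?thesis .
    qed
    then have "real (length w') \<le> real C * real ?n" by (metis of_nat_le_iff of_nat_mult)
    ultimately show ?thesis by blast
  qed
  then show ?thesis
    unfolding efficient_def using normal_words_subset[OF assms(6,7)] by blast
qed

end
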